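(* Every positive even number arises as the combinatorial period of a periodic trajectory on the double pentagon.
   Context: The double pentagon is the translation surface obtained from a regular pentagon $Q$ and its half-turn image $-Q$ by gluing each side of $Q$ by translation to the parallel side of $-Q$. The combinatorial period of a periodic straight-line trajectory (not hitting a vertex) is the number of times it crosses the glued pentagon sides in one primitive period. *)

theory Defs
  imports "HOL-Analysis.Analysis"
begin

text \<open>The pentagon is normalised to be centred at the origin and inscribed in the unit circle.
  Indices of vertices and sides are natural numbers, to be read modulo 5.\<close>

definition vertex :: "nat \<Rightarrow> complex" where
  "vertex k = cis (2 * pi * real k / 5)"

definition pentagon :: "complex set" where
  "pentagon = convex hull (vertex ` {..<5})"

definition side :: "nat \<Rightarrow> complex set" where
  "side k = closed_segment (vertex k) (vertex (Suc k))"

text \<open>The disjoint union of \<open>Q\<close> (left summand) and \<open>-Q\<close> (right summand), before gluing.\<close>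

definition polygons :: "(complex + complex) set" where
  "polygons = pentagon <+> uminus ` pentagon"

text \<open>The side of \<open>-Q\<close> parallel to \<open>side k\<close> is \<open>uminus ` side k\<close>. The translation carrying
  \<open>side k\<close> onto it takes \<open>vertex k\<close> to \<open>- vertex (Suc k)\<close> and \<open>vertex (Suc k)\<close> to
  \<open>- vertex k\<close>.\<close>

lemma side_translate:
  "(\<lambda>z. z - (vertex k + vertex (Suc k))) ` side k = uminus ` side k"
proof -
  have "(\<lambda>z. z - (vertex k + vertex (Suc k))) ` side k
      = (+) (- (vertex k + vertex (Suc k))) ` side k"
    by (rule image_cong) auto
  also have "\<dots> = closed_segment (- vertex (Suc k)) (- vertex k)"
    unfolding side_def closed_segment_translation[symmetric] by simp
  also have "\<dots> = uminus ` side k"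
    unfolding side_def
    by (subst closed_segment_commute)
       (rule closed_segment_linear_image, simp add: linear_uminus)
  finally show ?thesis .
qed

definition side_gluing :: "(complex + complex) rel" where
  "side_gluing = {(Inl z, Inr (z - (vertex k + vertex (Suc k)))) | z k. z \<in> side k}"

definition glue :: "(complex + complex) rel" where
  "glue = (side_gluing \<union> side_gluing\<inverse>)\<^sup>*"

definition double_pentagon :: "(complex + complex) set set" where
  "double_pentagon = polygons // glue"

definition glued_sides :: "(complex + complex) set set" where
  "glued_sides = {glue `` {Inl z} | z k. z \<in> side k}"

definition glued_vertices :: "(complex + complex) set set" where
  "glued_vertices = range (\<lambda>k. glue `` {Inl (vertex k)}) \<union> range (\<lambda>k. glue `` {Inr (- vertex k)})"

definition shift :: "complex \<Rightarrow> complex + complex \<Rightarrow> complex + complex" where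
  "shift w = map_sum ((+) w) ((+) w)"

text \<open>A unit-speed trajectory with constant direction \<open>u\<close>, defined for all times and
  never hitting a vertex. Shortly after and shortly before each time \<open>t\<close> it moves along a straight
  segment inside one of the two closed polygons, starting or ending at a representative of
  \<open>\<gamma> t\<close>. The two representatives differ exactly when the trajectory crosses a glued side at
  time \<open>t\<close>. A trajectory running along a side is excluded, as it would reach a vertex.\<close>

definition straight_trajectory :: "complex \<Rightarrow> (real \<Rightarrow> (complex + complex) set) \<Rightarrow> bool" where
  "straight_trajectory u \<gamma> \<longleftrightarrow>
     norm u = 1 \<and>
     (\<forall>t. \<gamma> t \<in> double_pentagon - glued_vertices) \<and>
     (\<forall>t. \<exists>\<epsilon>>0.
        (\<exists>p\<in>\<gamma> t. \<forall>s\<in>{0..<\<epsilon>}. shift (s *\<^sub>R u) p \<in> polygons \<and>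
           \<gamma> (t + s) = glue `` {shift (s *\<^sub>R u) p}) \<and>
        (\<exists>p\<in>\<gamma> t. \<forall>s\<in>{-\<epsilon><..0}. shift (s *\<^sub>R u) p \<in> polygons \<and>
           \<gamma> (t + s) = glue `` {shift (s *\<^sub>R u) p}))"

definition is_period :: "(real \<Rightarrow> 'a) \<Rightarrow> real \<Rightarrow> bool" where
  "is_period \<gamma> T \<longleftrightarrow> 0 < T \<and> (\<forall>t. \<gamma> (t + T) = \<gamma> t)"

definition periodic_trajectory :: "(real \<Rightarrow> (complex + complex) set) \<Rightarrow> bool" where
  "periodic_trajectory \<gamma> \<longleftrightarrow> (\<exists>u. straight_trajectory u \<gamma>) \<and> (\<exists>T. is_period \<gamma> T)"

text \<open>The least period exists for every periodic straight trajectory, since a straight trajectory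
  is injective on some nonempty interval.\<close>

definition primitive_period :: "(real \<Rightarrow> 'a) \<Rightarrow> real" where
  "primitive_period \<gamma> = (LEAST T. is_period \<gamma> T)"

definition combinatorial_period :: "(real \<Rightarrow> (complex + complex) set) \<Rightarrow> nat" where
  "combinatorial_period \<gamma> = card {t \<in> {0..<primitive_period \<gamma>}. \<gamma> t \<in> glued_sides}"

end

theory Submission
  imports Defs
begin

text \<open>Cut from \<open>Q\<close> the triangle at \<open>vertex 0\<close> and from \<open>-Q\<close> its image under the half-turn. The
  two remaining trapezoids, glued along sides 1 and 3, form a cylinder in the direction of side 2. A copy of side 2
  lies on each boundary of this cylinder, and these copies are glued to each other. The segment
  that starts at the midpoint of one copy, winds around the cylinder and ends at the midpoint of the
  other is therefore a closed geodesic. If it passes through \<open>2 * m + 2\<close> trapezoids, it crosses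
  \<open>2 * m + 1\<close> slanted sides and side 2 once. Since it meets side 2 only once, its period is
  primitive.\<close>

section \<open>Heights over the sides\<close>

text \<open>The component of \<open>z\<close> along the outward unit normal of side
  \<open>k\<close>, whose argument is \<open>(2 * k + 1) * pi / 5\<close>. The side lies at level
  \<open>cos (pi / 5)\<close>, the inradius of the pentagon, and the pentagon lies at or below that
  level.\<close>

definition height :: "nat \<Rightarrow> complex \<Rightarrow> real" where
  "height k z = Re (z * cis (- ((2 * real k + 1) * pi / 5)))"

definition open_side :: "nat \<Rightarrow> complex set" where
  "open_side k = open_segment (vertex k) (vertex (Suc k))"

text \<open>Twice the midpoint of side \<open>k\<close>. Hence \<open>z - side_shift k\<close> is
  the glued partner of \<open>z\<close>, and its negative is the reflection of \<open>z\<close> in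
  that midpoint.\<close>

definition side_shift :: "nat \<Rightarrow> complex" where
  "side_shift k = vertex k + vertex (Suc k)"

lemma vertex_mod: "vertex k = vertex (k mod 5)"
proof -
  have "2 * pi * real k / 5 = 2 * pi * real (k mod 5) / 5 + 2 * pi * real (k div 5)"
  proof -
    have "real k = real (k mod 5) + 5 * real (k div 5)"
      by (metis mod_mult_div_eq of_nat_add of_nat_mult of_nat_numeral)
    then show ?thesis by (simp add: field_simps)
  qed
  moreover have "cis (2 * pi * real (k div 5)) = 1"
    by (rule cis_multiple_2pi) simp
  ultimately show ?thesis
    unfolding vertex_def by (metis cis_mult mult.right_neutral)
qed

lemma vertex_Suc_mod: "vertex (Suc k) = vertex (Suc (k mod 5))"
  by (metis vertex_mod mod_Suc_eq)

lemma side_mod: "side k = side (k mod 5)"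
  unfolding side_def by (metis vertex_mod vertex_Suc_mod)

lemma side_shift_mod: "side_shift k = side_shift (k mod 5)"
  unfolding side_shift_def by (metis vertex_mod vertex_Suc_mod)

lemma height_add: "height k (x + y) = height k x + height k y"
  by (simp add: height_def algebra_simps)

lemma height_scaleR: "height k (a *\<^sub>R x) = a * height k x"
  by (simp add: height_def algebra_simps)

section \<open>Heights of the vertices: cosines of odd multiples of \<open>pi / 5\<close>\<close>

lemma height_vertex:
  "height k (vertex j) = cos (real_of_int (2 * (int k - int j) + 1) * pi / 5)"
proof -
  have "2 * pi * real j / 5 + - ((2 * real k + 1) * pi / 5)
      = - (real_of_int (2 * (int k - int j) + 1) * pi / 5)"
    by (simp add: field_simps)
  then show ?thesis
    unfolding height_def vertex_def cis_mult cis.sel by (metis cos_minus)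
qed

lemma cos_3_5_less: "cos (3 * pi / 5) < cos (pi / 5)"
  by (rule cos_monotone_0_pi) auto

lemma cos_7_5: "cos (7 * pi / 5) = cos (3 * pi / 5)"
  using cos_2pi_minus [of "3 * pi / 5"] by (simp add: field_simps)

lemma cos_9_5: "cos (9 * pi / 5) = cos (pi / 5)"
  using cos_2pi_minus [of "pi / 5"] by (simp add: field_simps)

lemma cos_5_5_less: "-1 < cos (pi / 5)"
  using cos_monotone_0_pi [of "pi / 5" pi] by auto

text \<open>Here \<open>d\<close> stands for \<open>k - j\<close>, and the range covers
  \<open>k < 5\<close> and \<open>j \<le> 5\<close>, so that the end \<open>Suc 4\<close> of the
  last side needs no reduction modulo 5. The first set collects the cases in which
  \<open>vertex j\<close> is an end of side \<open>k\<close>.\<close>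

lemma cos_odd_fifth:
  fixes d :: int
  assumes "-5 \<le> d" "d \<le> 4"
  shows "cos (real_of_int (2 * d + 1) * pi / 5) =
      (if d \<in> {-5, -1, 0, 4} then cos (pi / 5)
       else if d \<in> {-4, -2, 1, 3} then cos (3 * pi / 5) else -1)"
proof -
  consider "d = -5" | "d = -4" | "d = -3" | "d = -2" | "d = -1" | "d = 0" | "d = 1" | "d = 2"
    | "d = 3" | "d = 4"
    using assms by atomize_elim arith
  then show ?thesis
    by cases (simp_all add: cos_7_5 cos_9_5)
qed

lemma height_vertex_le:
  assumes "k < 5" "j \<le> 5"
  shows "height k (vertex j) \<le> cos (pi / 5)"
  unfolding height_vertex
  using assms cos_3_5_less cos_5_5_less by (subst cos_odd_fifth) auto

lemma height_vertex_less:
  assumes "k < 5" "j \<le> 5" "int k - int j \<notin> {-5, -1, 0, 4}"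
  shows "height k (vertex j) < cos (pi / 5)"
  unfolding height_vertex
  using assms cos_3_5_less cos_5_5_less by (subst cos_odd_fifth) auto

lemma height_side:
  assumes "k < 5" "z \<in> side k"
  shows "height k z = cos (pi / 5)"
proof -
  obtain t where "z = (1 - t) *\<^sub>R vertex k + t *\<^sub>R vertex (Suc k)"
    using assms by (auto simp: side_def in_segment)
  then show ?thesis
    using assms by (simp only: height_add height_scaleR height_vertex) (simp add: algebra_simps)
qed

lemma convex_combination_less:
  fixes x y a t :: real
  assumes "x \<le> a" "y \<le> a" "x < a \<or> y < a" "0 < t" "t < 1"
  shows "(1 - t) * x + t * y < a"
proof -
  have "(1 - t) * (a - x) + t * (a - y) > 0"
    using assms by (auto intro: add_pos_nonneg add_nonneg_pos)
  then show ?thesis by (simp add: algebra_simps)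
qed

text \<open>Distinct sides share at most one vertex, so at least one end of side \<open>a\<close>
  lies strictly below the level of side \<open>k\<close>, and the height is affine along side
  \<open>a\<close>.\<close>

lemma height_open_side_less:
  assumes "a < 5" "k < 5" "k \<noteq> a" "z \<in> open_side a"
  shows "height k z < cos (pi / 5)"
proof -
  obtain t where t: "0 < t" "t < 1" "z = (1 - t) *\<^sub>R vertex a + t *\<^sub>R vertex (Suc a)"
    using assms by (auto simp: open_side_def in_segment)
  have "int k - int a \<notin> {-5, -1, 0, 4} \<or> int k - int (Suc a) \<notin> {-5, -1, 0, 4}"
    using assms by auto
  then have "height k (vertex a) < cos (pi / 5) \<or> height k (vertex (Suc a)) < cos (pi / 5)"
    using assms by (metis height_vertex_less less_imp_le Suc_leI)
  then show ?thesis
    using t assms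
    by (simp add: height_add height_scaleR convex_combination_less height_vertex_le)
qed

lemma open_side_subset: "open_side k \<subseteq> side k"
  by (auto simp: open_side_def side_def segment_open_subset_closed)

lemma height_open_side_le:
  assumes "a < 5" "k < 5" "z \<in> open_side a"
  shows "height k z \<le> cos (pi / 5)"
  using assms height_open_side_less height_side open_side_subset
  by (metis less_imp_le order_refl subsetD)

lemma open_side_inj:
  assumes "a < 5" "k < 5" "z \<in> open_side a" "z \<in> side k"
  shows "k = a"
  using assms height_open_side_less height_side by (metis less_irrefl)

lemma vertex_in_side: "vertex j \<in> side j"
  by (simp add: side_def)

lemma vertex_notin_open_side:
  assumes "a < 5"
  shows "vertex j \<notin> open_side a"
proof
  assume v: "vertex j \<in> open_side a"
  \<comment> \<open>A vertex belongs to two different sides, those with indices \<open>j\<close> and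
    \<open>j + 4\<close> modulo 5, whereas a point of an open side belongs to only one.\<close>
  have "vertex j \<in> side (j mod 5)"
    using vertex_in_side side_mod by metis
  then have "j mod 5 = a"
    using open_side_inj v assms by auto
  moreover have "vertex j = vertex (Suc (j + 4))"
    using vertex_mod [of "Suc (j + 4)"] vertex_mod [of j] by simp
  then have "vertex j \<in> side (j + 4)"
    by (simp add: side_def)
  then have "vertex j \<in> side ((j + 4) mod 5)"
    using side_mod by metis
  then have "(j + 4) mod 5 = a"
    using open_side_inj v assms by auto
  ultimately show False
    by presburger
qed

text \<open>Negation turns statements about the partner in \<open>-Q\<close> into statements about
  \<open>Q\<close>; this is how every claim about \<open>-Q\<close> below is reduced to the
  heights.\<close>

lemma uminus_side_shift_side:
  assumes "z \<in> side k"
  shows "- (z - side_shift k) \<in> side k"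
  using assms side_translate [of k] by (force simp: side_shift_def)

lemma uminus_side_shift_open_side:
  assumes "z \<in> open_side k"
  shows "- (z - side_shift k) \<in> open_side k"
proof -
  obtain t where t: "0 < t" "t < 1" "z = (1 - t) *\<^sub>R vertex k + t *\<^sub>R vertex (Suc k)"
      "vertex k \<noteq> vertex (Suc k)"
    using assms by (auto simp: open_side_def in_segment)
  then have "- (z - side_shift k) = (1 - (1 - t)) *\<^sub>R vertex k + (1 - t) *\<^sub>R vertex (Suc k)"
    by (simp add: side_shift_def algebra_simps)
  moreover have "0 < 1 - t" "1 - t < 1"
    using t by auto
  ultimately show ?thesis
    using t(4) unfolding open_side_def in_segment by blast
qed

section \<open>The interior of the pentagon and its chords\<close>

lemma side_subset_pentagon: "side k \<subseteq> pentagon"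
proof -
  have "vertex j \<in> pentagon" for j
    using vertex_mod [of j] by (auto simp: pentagon_def intro!: hull_inc)
  then show ?thesis
    by (simp add: side_def closed_segment_subset pentagon_def)
qed

definition open_pentagon :: "complex set" where
  "open_pentagon = {z \<in> pentagon. \<forall>k<5. height k z < cos (pi / 5)}"

text \<open>Each side \<open>k\<close> differs from \<open>a\<close> or from \<open>b\<close>, so
  one end of the chord is strictly below its level while the other is at most at that level.\<close>

lemma open_segment_subset_open_pentagon:
  assumes "a < 5" "b < 5" "a \<noteq> b" "x \<in> open_side a" "y \<in> open_side b"
  shows "open_segment x y \<subseteq> open_pentagon"
proof
  fix z assume z: "z \<in> open_segment x y"
  then obtain t where t: "0 < t" "t < 1" "z = (1 - t) *\<^sub>R x + t *\<^sub>R y"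
    by (auto simp: in_segment)
  have "x \<in> pentagon" "y \<in> pentagon"
    using assms side_subset_pentagon open_side_subset by blast+
  then have "closed_segment x y \<subseteq> pentagon"
    by (intro closed_segment_subset) (auto simp: pentagon_def)
  then have "z \<in> pentagon"
    using z segment_open_subset_closed by blast
  moreover have "height k z < cos (pi / 5)" if "k < 5" for k
  proof -
    have "height k x < cos (pi / 5) \<or> height k y < cos (pi / 5)"
      using assms that height_open_side_less by metis
    moreover have "height k x \<le> cos (pi / 5)" "height k y \<le> cos (pi / 5)"
      using assms that height_open_side_le by blast+
    ultimately show ?thesis
      using t by (simp add: height_add height_scaleR convex_combination_less)
  qed
  ultimately show "z \<in> open_pentagon"
    by (simp add: open_pentagon_def)
qed

lemma open_pentagon_notin_side:
  assumes "z \<in> open_pentagon"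
  shows "z \<notin> side k"
proof -
  have k: "k mod 5 < 5" by simp
  then have "height (k mod 5) z < cos (pi / 5)"
    using assms by (simp add: open_pentagon_def)
  then show ?thesis
    using height_side [OF k, of z] side_mod [of k] by fastforce
qed

section \<open>Glueing classes\<close>

text \<open>Reduces the side index modulo 5, as the height estimates require.\<close>

lemma side_gluing_iff:
  "(p, q) \<in> side_gluing \<longleftrightarrow>
    (\<exists>z k. k < 5 \<and> p = Inl z \<and> q = Inr (z - side_shift k) \<and> z \<in> side k)"
proof
  assume "(p, q) \<in> side_gluing"
  then obtain z k where zk: "p = Inl z" "q = Inr (z - side_shift k)" "z \<in> side k"
    by (auto simp: side_gluing_def side_shift_def)
  then have "q = Inr (z - side_shift (k mod 5))" "z \<in> side (k mod 5)"
    using side_mod side_shift_mod by metis+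
  then show "\<exists>z k. k < 5 \<and> p = Inl z \<and> q = Inr (z - side_shift k) \<and> z \<in> side k"
    using zk(1) by (intro exI [of _ z] exI [of _ "k mod 5"]) simp
qed (auto simp: side_gluing_def side_shift_def)

lemma glue_class_eqI:
  assumes "(p, q) \<in> glue"
  shows "glue `` {p} = glue `` {q}"
proof -
  have "sym glue" "trans glue"
    by (simp_all add: glue_def sym_Un_converse sym_rtrancl trans_rtrancl)
  then show ?thesis
    using assms by (auto dest: symD transD)
qed

lemma glue_class_self: "p \<in> glue `` {p}"
  by (simp add: glue_def)

text \<open>An invariant-set principle: classes of the reflexive transitive closure are bounded by
  checking single gluings in both directions.\<close>

lemma glue_class_closed:
  assumes "\<And>q q'. q \<in> S \<Longrightarrow> (q, q') \<in> side_gluing \<or> (q', q) \<in> side_gluing \<Longrightarrow> q' \<in> S"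
    and "p \<in> S"
  shows "glue `` {p} \<subseteq> S"
proof -
  have "(side_gluing \<union> side_gluing\<inverse>) `` S \<subseteq> S"
    using assms(1) by auto
  then have "glue `` S = S"
    unfolding glue_def by (rule Image_closed_trancl)
  then show ?thesis
    using assms(2) by auto
qed

text \<open>The point lies on one side only, and so does its partner after negation. Each of the two
  thus admits a single gluing, and it leads to the other.\<close>

lemma glue_open_side:
  assumes "a < 5" "z \<in> open_side a"
  shows "glue `` {Inl z} = {Inl z, Inr (z - side_shift a)}"
    and "glue `` {Inr (z - side_shift a)} = {Inl z, Inr (z - side_shift a)}"
proof -
  have "(Inl z, Inr (z - side_shift a)) \<in> side_gluing"
    using assms open_side_subset by (auto simp: side_gluing_iff)
  then have rel: "(Inl z, Inr (z - side_shift a)) \<in> glue"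
    by (auto simp: glue_def)
  have k: "k = a" if "k < 5" "z' \<in> side k" "z - side_shift a = z' - side_shift k" for z' k
  proof -
    have "- (z - side_shift a) \<in> side k"
      using uminus_side_shift_side that by metis
    then show ?thesis
      using uminus_side_shift_open_side open_side_inj assms that by blast
  qed
  have "glue `` {Inl z} \<subseteq> {Inl z, Inr (z - side_shift a)}"
  proof (rule glue_class_closed)
    fix q q'
    assume "q \<in> {Inl z, Inr (z - side_shift a)}" "(q, q') \<in> side_gluing \<or> (q', q) \<in> side_gluing"
    then obtain w k where w: "k < 5" "w \<in> side k"
        "q = Inl w \<and> q' = Inr (w - side_shift k) \<or> q' = Inl w \<and> q = Inr (w - side_shift k)"
      unfolding side_gluing_iff by blast
    from w(3) show "q' \<in> {Inl z, Inr (z - side_shift a)}"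
    proof
      assume q: "q = Inl w \<and> q' = Inr (w - side_shift k)"
      then have "w = z"
        using \<open>q \<in> _\<close> by simp
      then show ?thesis
        using open_side_inj [OF assms(1) w(1) assms(2)] w(2) q by simp
    next
      assume q: "q' = Inl w \<and> q = Inr (w - side_shift k)"
      then have *: "z - side_shift a = w - side_shift k"
        using \<open>q \<in> _\<close> by simp
      then show ?thesis
        using k [OF w(1,2) *] q by simp
    qed
  qed simp
  moreover have "{Inl z, Inr (z - side_shift a)} \<subseteq> glue `` {Inl z}"
    using rel glue_class_self by auto
  ultimately show "glue `` {Inl z} = {Inl z, Inr (z - side_shift a)}"
    by blast
  then show "glue `` {Inr (z - side_shift a)} = {Inl z, Inr (z - side_shift a)}"
    using glue_class_eqI [OF rel] by simp
qed

lemma glue_open_pentagon: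
  assumes "z \<in> open_pentagon"
  shows "glue `` {Inl z} = {Inl z}" and "glue `` {Inr (- z)} = {Inr (- z)}"
proof -
  have "glue `` {Inl z} \<subseteq> {Inl z}"
    using assms open_pentagon_notin_side
    by (intro glue_class_closed) (auto simp: side_gluing_iff)
  then show "glue `` {Inl z} = {Inl z}"
    using glue_class_self by blast
  have no: "- z \<noteq> z' - side_shift k" if "z' \<in> side k" for z' k
    using uminus_side_shift_side [OF that] open_pentagon_notin_side assms
    by (metis minus_minus)
  have "glue `` {Inr (- z)} \<subseteq> {Inr (- z)}"
    using no by (intro glue_class_closed) (auto simp: side_gluing_iff)
  then show "glue `` {Inr (- z)} = {Inr (- z)}"
    using glue_class_self by blast
qed

section \<open>Which classes are vertices or lie on glued sides\<close>

lemma glued_vertices_cases: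
  assumes "X \<in> glued_vertices"
  obtains j where "Inl (vertex j) \<in> X \<or> Inr (- vertex j) \<in> X"
  using assms glue_class_self unfolding glued_vertices_def by blast

lemma glued_sides_cases:
  assumes "X \<in> glued_sides"
  obtains z k where "Inl z \<in> X" "z \<in> side k"
  using assms glue_class_self unfolding glued_sides_def by blast

lemma open_side_class:
  assumes "a < 5" "z \<in> open_side a"
  shows "glue `` {Inl z} \<in> glued_sides" "glue `` {Inl z} \<in> double_pentagon - glued_vertices"
proof -
  show "glue `` {Inl z} \<in> glued_sides"
    using assms open_side_subset unfolding glued_sides_def by blast
  have "z \<in> pentagon"
    using assms open_side_subset side_subset_pentagon by blast
  then have "glue `` {Inl z} \<in> double_pentagon"
    unfolding double_pentagon_def polygons_def by (intro quotientI) auto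
  moreover have "glue `` {Inl z} \<notin> glued_vertices"
  proof
    assume "glue `` {Inl z} \<in> glued_vertices"
    then obtain j where "Inl (vertex j) \<in> glue `` {Inl z} \<or> Inr (- vertex j) \<in> glue `` {Inl z}"
      by (rule glued_vertices_cases)
    then have "vertex j = z \<or> - vertex j = z - side_shift a"
      unfolding glue_open_side(1) [OF assms] by auto
    then have "vertex j = z \<or> vertex j = - (z - side_shift a)"
      by (metis minus_minus)
    then show False
      using assms vertex_notin_open_side uminus_side_shift_open_side by metis
  qed
  ultimately show "glue `` {Inl z} \<in> double_pentagon - glued_vertices" by simp
qed

lemma open_pentagon_class:
  assumes "z \<in> open_pentagon" "p = Inl z \<or> p = Inr (- z)"
  shows "p \<in> polygons" "glue `` {p} \<notin> glued_sides" "glue `` {p} \<in> double_pentagon - glued_vertices"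
proof -
  have cls: "glue `` {p} = {p}"
    using assms glue_open_pentagon by auto
  show "p \<in> polygons"
    using assms by (auto simp: polygons_def open_pentagon_def)
  then have "glue `` {p} \<in> double_pentagon"
    unfolding double_pentagon_def by (rule quotientI)
  moreover have "glue `` {p} \<notin> glued_vertices"
  proof
    assume "glue `` {p} \<in> glued_vertices"
    then obtain j where "Inl (vertex j) \<in> glue `` {p} \<or> Inr (- vertex j) \<in> glue `` {p}"
      by (rule glued_vertices_cases)
    then have "Inl (vertex j) = p \<or> Inr (- vertex j) = p"
      unfolding cls by simp
    then have "vertex j = z"
      using assms(2) by auto
    then show False
      using assms vertex_in_side open_pentagon_notin_side by metis
  qed
  ultimately show "glue `` {p} \<in> double_pentagon - glued_vertices" by simp
  show "glue `` {p} \<notin> glued_sides"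
  proof
    assume "glue `` {p} \<in> glued_sides"
    then obtain w k where "Inl w \<in> glue `` {p}" "w \<in> side k"
      by (rule glued_sides_cases)
    then have "w = z"
      using assms(2) unfolding cls by auto
    then show False
      using \<open>w \<in> side k\<close> open_pentagon_notin_side [OF assms(1)] by blast
  qed
qed

section \<open>Trajectories from cutting sequences\<close>

text \<open>The trajectory enters its \<open>i\<close>-th segment at time \<open>T i\<close> through the side \<open>K i\<close>; the entry
  point is \<open>c i\<close> in the coordinates of \<open>Q\<close>. Segments with even index run in \<open>Q\<close>, those with odd
  index in \<open>-Q\<close>.\<close>

locale cutting_sequence =
  fixes T :: "int \<Rightarrow> real" and K :: "int \<Rightarrow> nat" and c :: "int \<Rightarrow> complex"
    and u :: complex and N :: nat and L :: real
  assumes norm_u: "norm u = 1"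
    and T_step: "\<And>i. T i < T (i + 1)"
    and K_less: "\<And>i. K i < 5"
    and K_step: "\<And>i. K i \<noteq> K (i + 1)"
    and c_side: "\<And>i. c i \<in> open_side (K i)"
    and even_step: "\<And>i. even i \<Longrightarrow> c (i + 1) - c i = (T (i + 1) - T i) *\<^sub>R u"
    and odd_step: "\<And>i. odd i \<Longrightarrow>
        (c (i + 1) - side_shift (K (i + 1))) - (c i - side_shift (K i)) = (T (i + 1) - T i) *\<^sub>R u"
    and T_0: "T 0 = 0"
    and N_even: "even N" and L_pos: "0 < L"
    and T_period: "\<And>i. T (i + int N) = T i + L"
    and K_period: "\<And>i. K (i + int N) = K i"
    and c_period: "\<And>i. c (i + int N) = c i"
    and c_first: "\<And>i. c i = c 0 \<Longrightarrow> int N dvd i"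
begin

text \<open>An affine path in one polygon's own coordinates. Consecutive segments change polygon,
  and at time \<open>T (i + 1)\<close> segments \<open>i\<close> and \<open>i + 1\<close> give two
  representatives of the same class.\<close>

definition segment :: "int \<Rightarrow> real \<Rightarrow> complex + complex" where
  "segment i t = (if even i then Inl (c i + (t - T i) *\<^sub>R u)
     else Inr (c i - side_shift (K i) + (t - T i) *\<^sub>R u))"

lemma strict_mono_T: "strict_mono T"
proof (rule strict_monoI)
  fix i j :: int
  assume "i < j"
  then show "T i < T j"
  proof (induction j rule: int_gr_induct)
    case (step j)
    then show ?case using T_step [of j] by linarith
  qed (rule T_step)
qed

lemma T_multiple: "T (int N * q) = L * of_int q"
proof (induction q rule: int_induct [where k = 0])
  case (step1 q)
  then show ?case using T_period [of "int N * q"] by (simp add: algebra_simps)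
next
  case (step2 q)
  then show ?case using T_period [of "int N * (q - 1)"] by (simp add: algebra_simps)
qed (simp add: T_0)

text \<open>By \<open>T_multiple\<close> the crossing times are unbounded in both directions. Two
  consecutive multiples of the period bracket \<open>t\<close>, and finitely many steps between them
  find the interval.\<close>

lemma ex_index: "\<exists>i. T i \<le> t \<and> t < T (i + 1)"
proof -
  define q where "q = \<lfloor>t / L\<rfloor>"
  have "of_int q \<le> t / L" "t / L < of_int (q + 1)"
    by (simp_all add: q_def)
  then have 0: "T (int N * q) \<le> t" and 1: "t < T (int N * (q + 1))"
    unfolding T_multiple using L_pos by (simp_all add: field_simps)
  have "\<exists>i. T i \<le> t \<and> t < T (i + 1)" if "T a \<le> t" "t < T (a + int n)" for a n
    using that
  proof (induction n)
    case (Suc n)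
    then show ?case
      by (cases "t < T (a + int n)") (auto simp: algebra_simps intro!: exI [of _ "a + int n"])
  qed simp
  from this [OF 0, of N] 1 show ?thesis
    by (simp add: algebra_simps)
qed

definition index :: "real \<Rightarrow> int" where
  "index t = (SOME i. T i \<le> t \<and> t < T (i + 1))"

definition trajectory :: "real \<Rightarrow> (complex + complex) set" where
  "trajectory t = glue `` {segment (index t) t}"

lemma index_eqI:
  assumes "T i \<le> t" "t < T (i + 1)"
  shows "index t = i"
proof -
  have "T (index t) \<le> t \<and> t < T (index t + 1)"
    unfolding index_def by (rule someI_ex [OF ex_index])
  then have "T (index t) < T (i + 1)" "T i < T (index t + 1)"
    using assms by linarith+
  then show ?thesis
    by (simp add: strict_mono_less [OF strict_mono_T])
qed

lemma segment_start: "glue `` {segment i (T i)} = glue `` {Inl (c i)}"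
  using glue_open_side [OF K_less c_side] by (simp add: segment_def)

lemma segment_end: "glue `` {segment i (T (i + 1))} = glue `` {Inl (c (i + 1))}"
proof (cases "even i")
  case True
  then have "segment i (T (i + 1)) = Inl (c (i + 1))"
    by (simp add: segment_def flip: even_step)
  then show ?thesis by simp
next
  case False
  then have "segment i (T (i + 1)) = Inr (c (i + 1) - side_shift (K (i + 1)))"
    by (simp add: segment_def flip: odd_step)
  then show ?thesis
    using glue_open_side [OF K_less c_side] by simp
qed

lemma trajectory_T: "trajectory (T i) = glue `` {Inl (c i)}"
  using index_eqI [of i "T i"] T_step segment_start by (simp add: trajectory_def)

text \<open>The right end is included although \<open>index\<close> has already advanced there,
  since the end of a segment is glued to the start of the next. This gives straight motion on both
  sides of a crossing.\<close>

lemma trajectory_eq: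
  assumes "T i \<le> t" "t \<le> T (i + 1)"
  shows "trajectory t = glue `` {segment i t}"
proof (cases "t = T (i + 1)")
  case True
  then show ?thesis by (simp add: trajectory_T segment_end)
next
  case False
  then show ?thesis using assms index_eqI [of i t] by (simp add: trajectory_def)
qed

lemma segment_shift: "shift (s *\<^sub>R u) (segment i t) = segment i (t + s)"
  by (simp add: segment_def shift_def algebra_simps)

lemma segment_interior:
  assumes "T i < t" "t < T (i + 1)"
  obtains z where "z \<in> open_pentagon" "segment i t = Inl z \<or> segment i t = Inr (- z)"
proof -
  have inner: "x + (t - T i) *\<^sub>R u \<in> open_segment x y"
    if "y - x = (T (i + 1) - T i) *\<^sub>R u" for x y
  proof -
    define a where "a = (t - T i) / (T (i + 1) - T i)"
    have a: "0 < a" "a < 1" "t - T i = a * (T (i + 1) - T i)"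
      using assms by (auto simp: a_def)
    have "x + (t - T i) *\<^sub>R u = x + a *\<^sub>R (y - x)"
      unfolding that a(3) by simp
    also have "\<dots> = (1 - a) *\<^sub>R x + a *\<^sub>R y"
      by (simp add: algebra_simps)
    finally have "x + (t - T i) *\<^sub>R u = (1 - a) *\<^sub>R x + a *\<^sub>R y" .
    moreover have "(T (i + 1) - T i) *\<^sub>R u \<noteq> 0"
      using norm_u T_step [of i] by auto
    then have "x \<noteq> y"
      using that by auto
    ultimately show ?thesis
      using a unfolding in_segment by blast
  qed
  show ?thesis
  proof (cases "even i")
    case True
    have "open_segment (c i) (c (i + 1)) \<subseteq> open_pentagon"
      using open_segment_subset_open_pentagon K_less K_step c_side by blast
    then show ?thesis
      using that [of "c i + (t - T i) *\<^sub>R u"] inner [OF even_step [OF True]] True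
      by (auto simp: segment_def)
  next
    case False
    \<comment> \<open>For a segment in \<open>-Q\<close>, \<open>p i\<close> and
      \<open>p (i + 1)\<close> are its ends. Their negatives lie on open sides of \<open>Q\<close>,
      so the chord argument applies after a half-turn.\<close>
    define p where "p i = c i - side_shift (K i)" for i
    have "- p i \<in> open_side (K i)" for i
      unfolding p_def using uminus_side_shift_open_side c_side by blast
    then have "open_segment (- p i) (- p (i + 1)) \<subseteq> open_pentagon"
      using open_segment_subset_open_pentagon K_less K_step by blast
    moreover have "open_segment (- p i) (- p (i + 1)) = uminus ` open_segment (p i) (p (i + 1))"
      by (rule open_segment_linear_image) (auto simp: linear_uminus)
    moreover have "p i + (t - T i) *\<^sub>R u \<in> open_segment (p i) (p (i + 1))"
      using inner odd_step [OF False] by (simp add: p_def)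
    ultimately have "- (p i + (t - T i) *\<^sub>R u) \<in> open_pentagon"
      by blast
    then show ?thesis
      using that False by (metis segment_def p_def minus_minus)
  qed
qed

lemma segment_in_polygons:
  assumes "T i \<le> t" "t \<le> T (i + 1)"
  shows "segment i t \<in> polygons"
proof -
  \<comment> \<open>Any representative of the class of an entry point is one of the two points
    identified there, and both belong to the polygons.\<close>
  have end_point: "q \<in> polygons" if "glue `` {q} = glue `` {Inl (c j)}" for q j
  proof -
    have "c j \<in> pentagon" "- (c j - side_shift (K j)) \<in> pentagon"
      using c_side uminus_side_shift_open_side open_side_subset side_subset_pentagon by blast+
    moreover have "c j - side_shift (K j) = - (- (c j - side_shift (K j)))"
      by simp
    moreover have "q \<in> {Inl (c j), Inr (c j - side_shift (K j))}"
      using that glue_class_self glue_open_side(1) [OF K_less c_side] by metis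
    ultimately show ?thesis
      unfolding polygons_def by blast
  qed
  consider "t = T i" | "t = T (i + 1)" | "T i < t" "t < T (i + 1)"
    using assms by linarith
  then show ?thesis
  proof cases
    case 1
    show ?thesis
      unfolding 1 using segment_start by (rule end_point)
  next
    case 2
    show ?thesis
      unfolding 2 using segment_end by (rule end_point)
  next
    case 3
    then obtain z where "z \<in> open_pentagon" "segment i t = Inl z \<or> segment i t = Inr (- z)"
      by (rule segment_interior)
    then show ?thesis
      by (rule open_pentagon_class)
  qed
qed

lemma trajectory_interior:
  assumes "T i < t" "t < T (i + 1)"
  shows "trajectory t \<notin> glued_sides" "trajectory t \<in> double_pentagon - glued_vertices"
proof -
  obtain z where "z \<in> open_pentagon" "segment i t = Inl z \<or> segment i t = Inr (- z)"
    by (rule segment_interior [OF assms])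
  moreover have "trajectory t = glue `` {segment i t}"
    using assms trajectory_eq by simp
  ultimately show "trajectory t \<notin> glued_sides" "trajectory t \<in> double_pentagon - glued_vertices"
    using open_pentagon_class(2,3) [of z "segment i t"] by simp_all
qed

lemma trajectory_glued_sides: "trajectory t \<in> glued_sides \<longleftrightarrow> t \<in> range T"
proof
  assume t: "trajectory t \<in> glued_sides"
  obtain i where "T i \<le> t" "t < T (i + 1)"
    using ex_index by blast
  then show "t \<in> range T"
    using t trajectory_interior(1) [of i t] by (cases "t = T i") auto
qed (use trajectory_T open_side_class(1) [OF K_less c_side] in auto)

lemma straight_trajectory: "straight_trajectory u trajectory"
  unfolding straight_trajectory_def
proof (intro conjI allI)
  fix t
  obtain i where i: "T i \<le> t" "t < T (i + 1)"
    using ex_index by blast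
  show "trajectory t \<in> double_pentagon - glued_vertices"
  proof (cases "t = T i")
    case True
    then show ?thesis
      using trajectory_T open_side_class(2) [OF K_less c_side] by metis
  next
    case False
    then show ?thesis
      using i trajectory_interior(2) [of i t] by simp
  qed
  \<comment> \<open>Segment \<open>j\<close> is the one along which \<open>t\<close> is reached,
    segment \<open>i\<close> the one along which it is left; they differ exactly at a crossing,
    where \<open>j = i - 1\<close>.\<close>
  obtain j where j: "T j < t" "t \<le> T (j + 1)"
  proof (cases "t = T i")
    case True
    then show ?thesis
      using that [of "i - 1"] T_step [of "i - 1"] by simp
  next
    case False
    then show ?thesis
      using that [of i] i by simp
  qed
  define \<epsilon> where "\<epsilon> = min (T (i + 1) - t) (t - T j)"
  have "\<epsilon> > 0"
    using i j by (simp add: \<epsilon>_def)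
  moreover have "\<exists>p\<in>trajectory t. \<forall>s\<in>{0..<\<epsilon>}. shift (s *\<^sub>R u) p \<in> polygons \<and>
      trajectory (t + s) = glue `` {shift (s *\<^sub>R u) p}"
  proof
    show "segment i t \<in> trajectory t"
      using trajectory_eq [of i t] i glue_class_self by simp
    show "\<forall>s\<in>{0..<\<epsilon>}. shift (s *\<^sub>R u) (segment i t) \<in> polygons \<and>
        trajectory (t + s) = glue `` {shift (s *\<^sub>R u) (segment i t)}"
      using i by (auto simp: segment_shift \<epsilon>_def intro!: segment_in_polygons trajectory_eq)
  qed
  moreover have "\<exists>p\<in>trajectory t. \<forall>s\<in>{-\<epsilon><..0}. shift (s *\<^sub>R u) p \<in> polygons \<and>
      trajectory (t + s) = glue `` {shift (s *\<^sub>R u) p}"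
  proof
    show "segment j t \<in> trajectory t"
      using trajectory_eq [of j t] j glue_class_self by simp
    show "\<forall>s\<in>{-\<epsilon><..0}. shift (s *\<^sub>R u) (segment j t) \<in> polygons \<and>
        trajectory (t + s) = glue `` {shift (s *\<^sub>R u) (segment j t)}"
      using j by (auto simp: segment_shift \<epsilon>_def intro!: segment_in_polygons trajectory_eq)
  qed
  ultimately show "\<exists>\<epsilon>>0.
        (\<exists>p\<in>trajectory t. \<forall>s\<in>{0..<\<epsilon>}. shift (s *\<^sub>R u) p \<in> polygons \<and>
           trajectory (t + s) = glue `` {shift (s *\<^sub>R u) p}) \<and>
        (\<exists>p\<in>trajectory t. \<forall>s\<in>{-\<epsilon><..0}. shift (s *\<^sub>R u) p \<in> polygons \<and>
           trajectory (t + s) = glue `` {shift (s *\<^sub>R u) p})"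
    by blast
qed (rule norm_u)

section \<open>The primitive period and the number of crossings\<close>

lemma is_period_L: "is_period trajectory L"
  unfolding is_period_def
proof (intro conjI allI)
  fix t
  obtain i where i: "T i \<le> t" "t < T (i + 1)"
    using ex_index by blast
  have "T (i + 1 + int N) = T (i + 1) + L"
    by (rule T_period)
  then have "trajectory (t + L) = glue `` {segment (i + int N) (t + L)}"
    using i by (intro trajectory_eq) (simp_all add: T_period algebra_simps)
  \<comment> \<open>Evenness of \<open>N\<close> ensures that the segment one period later runs in
    the same polygon.\<close>
  also have "segment (i + int N) (t + L) = segment i t"
    using N_even by (simp add: segment_def T_period K_period c_period)
  also have "glue `` {segment i t} = trajectory t"
    using i trajectory_eq by simp
  finally show "trajectory (t + L) = trajectory t" .
qed (rule L_pos)

text \<open>A period carries the crossing at time 0 to another crossing, so it equals some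
  \<open>T i\<close>. The class there has a unique representative in \<open>Q\<close>, hence
  \<open>c i = c 0\<close>, and \<open>c_first\<close> makes \<open>i\<close> a multiple of
  \<open>N\<close>.\<close>

lemma period_ge_L:
  assumes "is_period trajectory S"
  shows "L \<le> S"
proof -
  have S: "0 < S" "trajectory S = trajectory (T 0)"
    using assms by (auto simp: is_period_def T_0 dest: spec [of _ 0])
  have "trajectory (T 0) \<in> glued_sides"
    by (simp add: trajectory_glued_sides)
  then have "S \<in> range T"
    unfolding trajectory_glued_sides [symmetric] S(2) .
  then obtain i where i: "S = T i"
    by blast
  have "Inl (c i) \<in> glue `` {Inl (c 0)}"
    using S(2) glue_class_self [of "Inl (c i)"] unfolding i trajectory_T by simp
  then have "c i = c 0"
    using glue_open_side(1) [OF K_less c_side] by simp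
  then obtain q where "i = int N * q"
    using c_first by blast
  then have "S = L * of_int q"
    using i T_multiple by simp
  moreover from this have "1 \<le> q"
    using S(1) L_pos by (simp add: zero_less_mult_iff)
  ultimately show ?thesis
    using L_pos by simp
qed

lemma periodic_trajectory: "periodic_trajectory trajectory"
  unfolding periodic_trajectory_def using straight_trajectory is_period_L by blast

lemma combinatorial_period: "combinatorial_period trajectory = N"
proof -
  have "primitive_period trajectory = L"
    unfolding primitive_period_def using is_period_L period_ge_L by (rule Least_equality)
  moreover have "{t \<in> {0..<L}. trajectory t \<in> glued_sides} = T ` {0..<int N}"
  proof -
    have T_N: "T (int N) = L"
      using T_multiple [of 1] by simp
    have "0 \<le> T i \<and> T i < L \<longleftrightarrow> 0 \<le> i \<and> i < int N" for i
      unfolding T_0 [symmetric] T_N [symmetric] strict_mono_less [OF strict_mono_T]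
        strict_mono_less_eq [OF strict_mono_T] by simp
    then show ?thesis
      unfolding trajectory_glued_sides image_def by fastforce
  qed
  moreover have "card (T ` {0..<int N}) = N"
    using strict_mono_T by (simp add: card_image strict_mono_imp_inj_on inj_on_subset)
  ultimately show ?thesis
    by (simp add: combinatorial_period_def)
qed

end

section \<open>The twisted trajectories\<close>

text \<open>These are the corners of the trapezoid left in \<open>Q\<close> after the triangle at
  \<open>vertex 0\<close> is cut off.\<close>

lemma vertex_coordinates:
  "vertex 1 = Complex (cos (2 * pi / 5)) (sin (2 * pi / 5))"
  "vertex 2 = Complex (- cos (pi / 5)) (sin (pi / 5))"
  "vertex 3 = Complex (- cos (pi / 5)) (- sin (pi / 5))"
  "vertex 4 = Complex (cos (2 * pi / 5)) (- sin (2 * pi / 5))"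
proof -
  have 2: "2 * pi * 2 / 5 = pi - pi / 5" and 3: "2 * pi * 3 / 5 = pi / 5 + pi"
    and 4: "2 * pi * 4 / 5 = 2 * pi - 2 * pi / 5"
    by simp_all
  show "vertex 1 = Complex (cos (2 * pi / 5)) (sin (2 * pi / 5))"
    by (simp add: vertex_def complex_eq_iff)
  show "vertex 2 = Complex (- cos (pi / 5)) (sin (pi / 5))"
    unfolding vertex_def of_nat_numeral 2
    by (simp only: complex_eq_iff cis.sel complex.sel cos_pi_minus sin_pi_minus)
  show "vertex 3 = Complex (- cos (pi / 5)) (- sin (pi / 5))"
    unfolding vertex_def of_nat_numeral 3
    by (simp only: complex_eq_iff cis.sel complex.sel cos_periodic_pi sin_periodic_pi)
  show "vertex 4 = Complex (cos (2 * pi / 5)) (- sin (2 * pi / 5))"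
    unfolding vertex_def of_nat_numeral 4
    by (simp only: complex_eq_iff cis.sel complex.sel cos_2pi_minus sin_2pi_minus)
qed

context
  fixes m :: nat
begin

text \<open>\<open>Q\<close> minus its triangle at \<open>vertex 0\<close> has width \<open>W\<close> and vertical parallel edges of lengths
  \<open>2 * h\<close> and \<open>2 * H\<close>.\<close>

private definition H :: real where "H = sin (2 * pi / 5)"
private definition h :: real where "h = sin (pi / 5)"
private definition W :: real where "W = cos (pi / 5) + cos (2 * pi / 5)"

text \<open>In the unfolded cylinder, of circumference \<open>2 * (H + h)\<close>, the copies of
  side 2 on the right boundary have their midpoints at odd multiples of \<open>H + h\<close> above
  the midpoint of the starting copy on the left. \<open>M\<close> selects one of them.\<close>

private definition M :: real where "M = (2 * real m + 1) * (H + h)"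

text \<open>The line \<open>(r * W - cos (pi / 5), r * M)\<close> meets the \<open>j\<close>-th slanted side of the cylinder
  at parameter \<open>r = crossing j\<close>, where
  \<open>r * M = (j - 1) * H + j * h + r * (H - h)\<close> for odd \<open>j\<close> and
  \<open>r * M = j * H + (j - 1) * h - r * (H - h)\<close> for even \<open>j\<close>.\<close>

private definition crossing :: "int \<Rightarrow> real" where
  "crossing j =
    (if j = 0 then 0
     else if odd j then (of_int (j - 1) * H + of_int j * h) / (M - (H - h))
     else (of_int j * H + of_int (j - 1) * h) / (M + (H - h)))"

text \<open>The line climbs: it leaves \<open>Q\<close> through its upper slanted side 1, and leaves
  \<open>-Q\<close> through the upper slanted side there, which is glued to the lower side 3 of
  \<open>Q\<close>. Index 0 is the start on side 2.\<close>

private definition crossing_side :: "int \<Rightarrow> nat" where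
  "crossing_side j = (if j = 0 then 2 else if odd j then 1 else 3)"

private definition crossing_point :: "int \<Rightarrow> complex" where
  "crossing_point j = Complex (crossing j * W - cos (pi / 5))
    (if j = 0 then 0
     else if odd j then h + crossing j * (H - h)
     else - h - crossing j * (H - h))"

section \<open>Position of the crossings along the cylinder\<close>

private lemma h_pos: "0 < h" and h_less_H: "h < H" and W_pos: "0 < W"
proof -
  show "0 < h"
    by (simp add: h_def sin_gt_zero)
  show "h < H"
    unfolding h_def H_def by (rule sin_monotone_2pi) (use pi_gt_zero in linarith)+
  show "0 < W"
    unfolding W_def by (intro add_pos_pos cos_gt_zero) auto
qed

private lemma M_pos: "0 < M"
  unfolding M_def using h_pos h_less_H by simp

private lemma M_expand: "M = 2 * real m * H + 2 * real m * h + H + h"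
  by (simp add: M_def algebra_simps)

private lemma M_minus_pos: "0 < M - (H - h)"
proof -
  have "0 \<le> 2 * real m * H" "0 \<le> 2 * real m * h"
    using h_pos h_less_H by simp_all
  then show ?thesis
    unfolding M_expand using h_pos by linarith
qed

private lemma crossing_odd:
  assumes "odd j"
  shows "crossing j * (M - (H - h)) = of_int (j - 1) * H + of_int j * h"
proof -
  have "j \<noteq> 0" using assms by auto
  then show ?thesis using assms M_minus_pos by (simp add: crossing_def)
qed

private lemma crossing_even:
  assumes "even j" "j \<noteq> 0"
  shows "crossing j * (M + (H - h)) = of_int j * H + of_int (j - 1) * h"
proof -
  have "M + (H - h) \<noteq> 0"
    using M_pos h_less_H by linarith
  then show ?thesis using assms by (simp add: crossing_def)
qed

text \<open>The numerators grow with \<open>j\<close>, so the largest odd index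
  \<open>2 * m + 1\<close> and the largest even index \<open>2 * m\<close> decide. There the
  numerator falls short of the denominator by \<open>h\<close> and by \<open>2 * H + h\<close>
  respectively.\<close>

private lemma crossing_bounds:
  assumes "0 < j" "j < 2 * int m + 2"
  shows "0 < crossing j" "crossing j < 1"
proof -
  have pos: "0 < H" "0 < h" "0 < M + (H - h)"
    using h_pos h_less_H M_pos by linarith+
  have "0 < crossing j \<and> crossing j < 1"
  proof (cases "odd j")
    case True
    have "real_of_int j \<le> 2 * real m + 1" "1 \<le> real_of_int j"
      using assms by linarith+
    then have "real_of_int (j - 1) * H \<le> 2 * real m * H" "real_of_int j * h \<le> (2 * real m + 1) * h"
        "0 \<le> real_of_int (j - 1) * H" "0 < real_of_int j * h"
      using pos by (simp_all add: mult_right_mono)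
    then have "0 < real_of_int (j - 1) * H + real_of_int j * h"
        "real_of_int (j - 1) * H + real_of_int j * h < M - (H - h)"
      unfolding M_expand using pos(2) by (linarith, simp add: algebra_simps)
    then show ?thesis
      using True assms M_minus_pos by (simp add: crossing_def)
  next
    case False
    then have "2 \<le> j" "j \<le> 2 * int m"
      using assms by presburger+
    then have "real_of_int j \<le> 2 * real m" "2 \<le> real_of_int j"
      by linarith+
    then have "real_of_int j * H \<le> 2 * real m * H" "real_of_int (j - 1) * h \<le> 2 * real m * h"
        "0 < real_of_int j * H" "0 < real_of_int (j - 1) * h"
      using pos by (simp_all add: mult_right_mono)
    then have "0 < real_of_int j * H + real_of_int (j - 1) * h"
        "real_of_int j * H + real_of_int (j - 1) * h < M + (H - h)"
      unfolding M_expand using pos by linarith+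
    then show ?thesis
      using False assms pos(3) by (simp add: crossing_def)
  qed
  then show "0 < crossing j" "crossing j < 1" by blast+
qed

private lemma crossing_point_open_side:
  assumes "0 \<le> j" "j < 2 * int m + 2"
  shows "crossing_point j \<in> open_side (crossing_side j)"
proof -
  have H: "Complex (cos (2 * pi / 5)) (sin (2 * pi / 5)) = Complex (W - cos (pi / 5)) H"
      "Complex (cos (2 * pi / 5)) (- sin (2 * pi / 5)) = Complex (W - cos (pi / 5)) (- H)"
    by (simp_all add: W_def H_def)
  note v = vertex_coordinates [unfolded H, folded h_def]
  consider "j = 0" | "j \<noteq> 0" "odd j" | "j \<noteq> 0" "even j"
    by blast
  then show ?thesis
  proof cases
    case 1
    have "Complex (- cos (pi / 5)) 0 \<in> open_segment (vertex 2) (vertex 3)"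
      unfolding in_segment v
      using h_pos by (auto simp: complex_eq_iff intro!: exI [of _ "1 / 2"])
    then show ?thesis
      using 1 by (simp add: crossing_point_def crossing_side_def crossing_def open_side_def
          eval_nat_numeral)
  next
    case 2
    then have "0 < crossing j" "crossing j < 1"
      using assms crossing_bounds by auto
    \<comment> \<open>Side 1 runs from right to left while \<open>crossing\<close> is measured from
      the left, so the segment parameter is \<open>1 - crossing j\<close>.\<close>
    then have "crossing_point j \<in> open_segment (vertex 1) (vertex 2)"
      unfolding in_segment v
      using 2 W_pos by (auto simp: complex_eq_iff crossing_point_def algebra_simps
          intro!: exI [of _ "1 - crossing j"])
    then show ?thesis
      using 2 by (simp add: crossing_side_def open_side_def eval_nat_numeral)
  next
    case 3
    then have "0 < crossing j" "crossing j < 1"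
      using assms crossing_bounds by auto
    then have "crossing_point j \<in> open_segment (vertex 3) (vertex 4)"
      unfolding in_segment v
      using 3 W_pos by (auto simp: complex_eq_iff crossing_point_def algebra_simps
          intro!: exI [of _ "crossing j"])
    then show ?thesis
      using 3 by (simp add: crossing_side_def open_side_def eval_nat_numeral)
  qed
qed

section \<open>Displacements between consecutive crossings\<close>

private lemma side_shifts:
  "side_shift 1 = Complex (W - 2 * cos (pi / 5)) (H + h)"
  "side_shift 2 = Complex (- 2 * cos (pi / 5)) 0"
  "side_shift 3 = Complex (W - 2 * cos (pi / 5)) (- H - h)"
proof -
  have Suc: "Suc 1 = 2" "Suc 2 = 3" "Suc 3 = 4"
    by simp_all
  show "side_shift 1 = Complex (W - 2 * cos (pi / 5)) (H + h)"
    "side_shift 2 = Complex (- 2 * cos (pi / 5)) 0"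
    "side_shift 3 = Complex (W - 2 * cos (pi / 5)) (- H - h)"
    unfolding side_shift_def Suc vertex_coordinates
    by (simp_all add: W_def H_def h_def complex_eq_iff)
qed

text \<open>The holonomy vector of the closed geodesic: across the whole width of the cylinder and
  up by \<open>M\<close>.\<close>

private definition V :: complex where "V = Complex W M"

private lemma crossing_point_even_step:
  assumes "even j"
  shows "crossing_point (j + 1) - crossing_point j = (crossing (j + 1) - crossing j) *\<^sub>R V"
proof -
  have "j + 1 \<noteq> 0" using assms by presburger
  then show ?thesis
    using crossing_odd [of "j + 1"] crossing_even [of j] assms
    by (cases "j = 0") (simp_all add: crossing_point_def V_def complex_eq_iff crossing_def [of 0]
        algebra_simps)
qed

text \<open>The two shifts differ by the circumference \<open>2 * (H + h)\<close> in the vertical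
  direction, which compensates for the drop from side 1 to side 3 in the coordinates of
  \<open>Q\<close>.\<close>

private lemma crossing_point_odd_step:
  assumes "odd j" "0 < j"
  shows "(crossing_point (j + 1) - side_shift 3) - (crossing_point j - side_shift 1)
    = (crossing (j + 1) - crossing j) *\<^sub>R V"
  using crossing_odd [of j] crossing_even [of "j + 1"] assms
  by (auto simp: crossing_point_def V_def complex_eq_iff side_shifts algebra_simps
      simp del: One_nat_def)

text \<open>The final segment ends at parameter 1 on the right boundary, at the midpoint of the side
  of \<open>-Q\<close> glued to side 2, and so closes up with the start.\<close>

private lemma crossing_point_last_step:
  assumes "j = 2 * int m + 1"
  shows "(crossing_point 0 - side_shift 2) - (crossing_point j - side_shift 1)
    = (1 - crossing j) *\<^sub>R V"
proof -
  have "j \<noteq> 0" "odd j" "real_of_int j = 2 * real m + 1" using assms by auto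
  then show ?thesis
    using crossing_odd [of j]
    by (simp add: crossing_point_def V_def complex_eq_iff side_shifts crossing_def [of 0]
        M_expand algebra_simps del: One_nat_def)
qed

text \<open>The increment times \<open>M\<close> is the vertical gap between the entry and exit
  sides. In \<open>Q\<close> it is at least \<open>h\<close>, the case \<open>j = 0\<close> starting
  from a midpoint; in \<open>-Q\<close> it is at least
  \<open>2 * H - 2 * (H - h) = 2 * h\<close>.\<close>

private lemma crossing_less:
  assumes "0 \<le> j" "j + 1 < 2 * int m + 2"
  shows "crossing j < crossing (j + 1)"
proof (cases "even j")
  case True
  have "0 \<le> crossing j" "0 < crossing (j + 1)"
    using crossing_bounds [of j] crossing_bounds [of "j + 1"] assms
    by (cases "j = 0"; simp add: crossing_def [of 0])+
  then have "0 \<le> crossing j * (H - h)" "0 < crossing (j + 1) * (H - h)"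
    using h_less_H by simp_all
  moreover have "(crossing (j + 1) - crossing j) * M = crossing (j + 1) * (H - h) + crossing j * (H - h)
      + (if j = 0 then h else 2 * h)"
    using crossing_odd [of "j + 1"] crossing_even [of j] True
    by (auto simp: crossing_def [of 0] algebra_simps)
  moreover have "0 < (if j = 0 then h else 2 * h)"
    using h_pos by simp
  ultimately have "0 < (crossing (j + 1) - crossing j) * M"
    by linarith
  then show ?thesis
    using M_pos by (simp add: zero_less_mult_iff)
next
  case False
  then have "0 < j" using assms by presburger
  then have "crossing j * (H - h) \<le> 1 * (H - h)" "crossing (j + 1) * (H - h) \<le> 1 * (H - h)"
    using crossing_bounds [of j] crossing_bounds [of "j + 1"] assms h_less_H
    by (auto intro!: mult_right_mono)
  moreover have "(crossing (j + 1) - crossing j) * M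
      = 2 * H - crossing (j + 1) * (H - h) - crossing j * (H - h)"
    using crossing_odd [of j] crossing_even [of "j + 1"] False \<open>0 < j\<close>
    by (auto simp: algebra_simps)
  ultimately have "0 < (crossing (j + 1) - crossing j) * M"
    using h_pos by simp
  then show ?thesis
    using M_pos by (simp add: zero_less_mult_iff)
qed

lemma ex_periodic_trajectory:
  "\<exists>\<gamma>. periodic_trajectory \<gamma> \<and> combinatorial_period \<gamma> = 2 * m + 2"
proof -
  define N where "N = 2 * m + 2"
  \<comment> \<open>The \<open>2 * m + 2\<close> crossings of one period are repeated:
    \<open>j i\<close> is the position within the period, and \<open>T i\<close> adds the completed
    periods to the fraction \<open>crossing (j i)\<close> of the current one.\<close>
  define j where "j i = i mod int N" for i
  define L where "L = norm V"
  define T where "T i = L * (of_int (i div int N) + crossing (j i))" for i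
  have L_pos: "0 < L"
    using W_pos by (auto simp: L_def V_def complex_eq_iff)
  have j_bounds: "0 \<le> j i" "j i < 2 * int m + 2" for i
    using pos_mod_bound [of "2 * int m + 2" i] by (simp_all add: j_def N_def add.commute)
  have parity: "even (j i) \<longleftrightarrow> even i" for i
    unfolding j_def N_def by (simp add: dvd_mod_iff)
  have step: "j (i + 1) = j i + 1 \<and> T (i + 1) - T i = L * (crossing (j i + 1) - crossing (j i))"
    if "j i + 1 < 2 * int m + 2" for i
  proof -
    have "i + 1 = int N * (i div int N) + (j i + 1)"
      by (simp add: j_def)
    moreover have "0 \<le> j i + 1" "j i + 1 < int N"
      using that j_bounds [of i] by (simp_all add: N_def)
    ultimately have "(i + 1) div int N = i div int N" "(i + 1) mod int N = j i + 1"
      using int_div_pos_eq int_mod_pos_eq by blast+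
    then show ?thesis
      by (simp add: T_def j_def algebra_simps)
  qed
  have wrap: "j (i + 1) = 0 \<and> T (i + 1) - T i = L * (1 - crossing (j i))"
    if "j i = 2 * int m + 1" for i
  proof -
    have "i + 1 = int N * (i div int N) + (j i + 1)"
      by (simp add: j_def)
    then have "i + 1 = int N * (i div int N + 1) + 0"
      using that by (simp add: N_def algebra_simps)
    moreover have "0 < int N"
      by (simp add: N_def)
    ultimately have "(i + 1) div int N = i div int N + 1" "(i + 1) mod int N = 0"
      using int_div_pos_eq [of "i + 1" "int N" _ 0] int_mod_pos_eq [of "i + 1" "int N" _ 0] by blast+
    then show ?thesis
      by (simp add: T_def j_def crossing_def [of 0] algebra_simps)
  qed
  have step_cases: "j i + 1 < 2 * int m + 2 \<or> j i = 2 * int m + 1" for i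
    using j_bounds [of i] by linarith
  have V: "(L * a) *\<^sub>R (V /\<^sub>R L) = a *\<^sub>R V" for a
    using L_pos by simp
  interpret cutting_sequence T "\<lambda>i. crossing_side (j i)" "\<lambda>i. crossing_point (j i)" "V /\<^sub>R L" N L
  proof
    show "norm (V /\<^sub>R L) = 1"
      using L_pos by (simp add: L_def)
    show "even N" "0 < L"
      using L_pos by (simp_all add: N_def)
    show "T 0 = 0"
      by (simp add: T_def j_def crossing_def)
    fix i
    show "T i < T (i + 1)"
    proof -
      from step_cases [of i] obtain d where "T (i + 1) - T i = L * d" "0 < d"
        using step [of i] wrap [of i] crossing_less [OF j_bounds(1)]
          crossing_bounds(2) [of "j i"] j_bounds(2) [of i] by fastforce
      then have "0 < T (i + 1) - T i"
        using L_pos by simp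
      then show ?thesis by simp
    qed
    show "crossing_side (j i) < 5"
      by (simp add: crossing_side_def)
    show "crossing_side (j i) \<noteq> crossing_side (j (i + 1))"
      using step_cases [of i] step [of i] wrap [of i] by (auto simp: crossing_side_def)
    show "crossing_point (j i) \<in> open_side (crossing_side (j i))"
      using j_bounds crossing_point_open_side by blast
    show "crossing_point (j (i + 1)) - crossing_point (j i) = (T (i + 1) - T i) *\<^sub>R (V /\<^sub>R L)"
      if "even i"
    proof -
      have "even (j i)"
        using that parity by simp
      \<comment> \<open>The last position \<open>2 * m + 1\<close> is odd, so an even step never
        wraps around.\<close>
      then have "j i + 1 < 2 * int m + 2"
        using step_cases [of i] by auto
      then show ?thesis
        using step [of i] crossing_point_even_step [OF \<open>even (j i)\<close>] L_pos by simp
    qed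
    show "(crossing_point (j (i + 1)) - side_shift (crossing_side (j (i + 1))))
        - (crossing_point (j i) - side_shift (crossing_side (j i)))
        = (T (i + 1) - T i) *\<^sub>R (V /\<^sub>R L)"
      if "odd i"
    proof -
      have odd: "odd (j i)"
        using that parity by simp
      then have "0 < j i" "crossing_side (j i) = 1"
        using j_bounds(1) [of i] by (auto simp: crossing_side_def le_less)
      moreover have "crossing_side (j i + 1) = 3"
        using odd \<open>0 < j i\<close> by (simp add: crossing_side_def)
      moreover have "crossing_side 0 = 2"
        by (simp add: crossing_side_def)
      \<comment> \<open>An odd step either ends on side 3 within the period or, from the last
        position, wraps around to side 2.\<close>
      ultimately show ?thesis
        using step_cases [of i] step [of i] wrap [of i] V odd
          crossing_point_odd_step [of "j i"] crossing_point_last_step [of "j i"] by metis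
    qed
    have "j (i + int N) = j i"
      by (simp add: j_def)
    then show "crossing_side (j (i + int N)) = crossing_side (j i)"
        "crossing_point (j (i + int N)) = crossing_point (j i)"
      by simp_all
    have "(i + int N) div int N = i div int N + 1"
      by (simp add: N_def)
    then show "T (i + int N) = T i + L"
      using \<open>j (i + int N) = j i\<close> by (simp add: T_def algebra_simps)
    show "int N dvd i" if "crossing_point (j i) = crossing_point (j 0)"
    proof -
      \<comment> \<open>Comparing real parts suffices: among the crossing points only the one on
        side 2 lies on the left edge of the trapezoid.\<close>
      have "crossing (j i) * W = 0"
        using that by (simp add: crossing_point_def j_def crossing_def [of 0])
      then have "crossing (j i) = 0"
        using W_pos by simp
      then have "j i = 0"
        using crossing_bounds(1) [of "j i"] j_bounds [of i] by (cases "j i = 0") auto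
      then show ?thesis
        by (simp add: j_def dvd_eq_mod_eq_0)
    qed
  qed
  show ?thesis
    using periodic_trajectory combinatorial_period unfolding N_def by blast
qed

end

theorem proposition4p1:
  fixes n :: nat
  assumes "0 < n" and "even n"
  shows "\<exists>\<gamma>. periodic_trajectory \<gamma> \<and> combinatorial_period \<gamma> = n"
proof -
  obtain k where "n = 2 * k"
    using assms(2) by blast
  \<comment> \<open>Positivity of \<open>n\<close> gives \<open>1 \<le> k\<close>, so the
    subtraction of naturals is exact.\<close>
  then have "n = 2 * (k - 1) + 2"
    using assms(1) by simp
  then show ?thesis
    using ex_periodic_trajectory [of "k - 1"] by simp
qed

end
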